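(* Let $\Omega\subseteq\mathbb{R}^n$ be open, $u:\Omega\to\mathbb{R}^N$ continuous, $x\in\Omega$ and $\xi\in\mathbb{S}^{N-1}$. Let $D^{2,\xi}u(x)$ be the set of pairs $(D\psi(x),D^2\psi(x))$ where $\psi\in C^2(\mathbb{R}^n)^N$ ranges over maps with $\psi(x)=u(x)$ such that for every $L>0$ there is a neighbourhood of $x$ in $\Omega$ on which $|\xi^\perp(u-\psi)(y)|^2\le L^2|y-x|^2\,[-\xi^\top(u-\psi)(y)]$. Then $D^{2,\xi}u(x)=J^{2,\xi}u(x)$.
   Context: Notation: summation over repeated indices; $\mathbb{R}^N\otimes\mathbb{R}^{n\times n}_s$ is the space of arrays $\mathbf{X}=(\mathbf{X}_{\alpha ij})$ ($\alpha\le N$, $i,j\le n$) symmetric in $i,j$; $\mathbf{X}:z\otimes z\in\mathbb{R}^N$ has components $\mathbf{X}_{\alpha ij}z_iz_j$. For $a,b\in\mathbb{R}^N$, $a\vee b:=\frac12(a\otimes b+b\otimes a)$; matrix inequalities are in the sense of quadratic forms. For $\xi\in\mathbb{S}^{N-1}$, $\xi^\perp:=I-\xi\otimes\xi$ (orthogonal projection onto the hyperplane normal to $\xi$) and $\xi^\top v$ is the inner product. Second contact jet: $J^{2,\xi}u(x)$ is the set of $(P,\mathbf{X})\in\mathbb{R}^{N\times n}\times(\mathbb{R}^N\otimes\mathbb{R}^{n\times n}_s)$ such that there is a continuous $T:\mathbb{R}^n\setminus\{0\}\to\mathbb{R}^{N\times N}_s$ with $|T(y)|\to0$ as $y\to0$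 and $\xi\vee[u(z)-u(x)-P(z-x)-\frac12\mathbf{X}:(z-x)\otimes(z-x)]\le|z-x|^2T(z-x)$ for all $z\ne x$ near $x$. *)

theory Defs
  imports "HOL-Analysis.Analysis"
begin

text \<open>Vectors in R^n are real^'n, in R^N are real^'N. A matrix P in R^(N x n) is
  real^'n^'N (acting by P *v h). An array X in R^N (x) R^(n x n) is real^'n^'n^'N,
  X $ alpha $ i $ j = X_(alpha i j).\<close>

definition Dmat :: "(real^'n \<Rightarrow> real^'N) \<Rightarrow> real^'n \<Rightarrow> real^'n^'N" where
  "Dmat f x = jacobian f (at x)"

text \<open>Second derivative array: D2arr f x $ alpha $ i $ j = d_j d_i f_alpha (x).\<close>
definition D2arr :: "(real^'n \<Rightarrow> real^'N) \<Rightarrow> real^'n \<Rightarrow> real^'n^'n^'N" where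
  "D2arr f x = (\<chi> \<alpha>. jacobian (\<lambda>y. Dmat f y $ \<alpha>) (at x))"

definition C2 :: "(real^'n \<Rightarrow> real^'N) \<Rightarrow> bool" where
  "C2 f \<longleftrightarrow> (\<forall>x. f differentiable at x)
     \<and> (\<forall>x \<alpha>. (\<lambda>y. Dmat f y $ \<alpha>) differentiable at x)
     \<and> continuous_on UNIV (D2arr f)"

definition quadform :: "real^'n^'n^'N \<Rightarrow> real^'n \<Rightarrow> real^'N" where
  "quadform X h = (\<chi> \<alpha>. h \<bullet> ((X $ \<alpha>) *v h))"

definition vee :: "real^'N \<Rightarrow> real^'N \<Rightarrow> real^'N^'N" where
  "vee a b = (\<chi> i j. (a $ i * b $ j + b $ i * a $ j) / 2)"

definition mat_le :: "real^'N^'N \<Rightarrow> real^'N^'N \<Rightarrow> bool" where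
  "mat_le A B \<longleftrightarrow> (\<forall>v. v \<bullet> (A *v v) \<le> v \<bullet> (B *v v))"

definition perp :: "real^'N \<Rightarrow> real^'N \<Rightarrow> real^'N" where
  "perp \<xi> v = v - (\<xi> \<bullet> v) *\<^sub>R \<xi>"

definition J2xi :: "(real^'n \<Rightarrow> real^'N) \<Rightarrow> real^'N \<Rightarrow> real^'n
     \<Rightarrow> ((real^'n^'N) \<times> (real^'n^'n^'N)) set" where
  "J2xi u \<xi> x = {(P, X). (\<forall>\<alpha>. transpose (X $ \<alpha>) = X $ \<alpha>) \<and>
     (\<exists>T :: real^'n \<Rightarrow> real^'N^'N.
        continuous_on (- {0}) T \<and> (\<forall>y. y \<noteq> 0 \<longrightarrow> transpose (T y) = T y) \<and>
        (T \<longlongrightarrow> 0) (at 0) \<and>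
        (\<forall>\<^sub>F z in at x. mat_le
            (vee \<xi> (u z - u x - P *v (z - x) - (1/2) *\<^sub>R quadform X (z - x)))
            ((norm (z - x))\<^sup>2 *\<^sub>R T (z - x))))}"

text \<open>The set D^{2,xi} u(x) (neighbourhood of x in the open set Omega = eventually in nhds x).\<close>
definition D2xi :: "(real^'n \<Rightarrow> real^'N) \<Rightarrow> real^'N \<Rightarrow> real^'n
     \<Rightarrow> ((real^'n^'N) \<times> (real^'n^'n^'N)) set" where
  "D2xi u \<xi> x = {(Dmat \<psi> x, D2arr \<psi> x) | \<psi>. C2 \<psi> \<and> \<psi> x = u x \<and>
     (\<forall>L>0. \<forall>\<^sub>F y in nhds x.
        (norm (perp \<xi> (u y - \<psi> y)))\<^sup>2 \<le> L\<^sup>2 * (norm (y - x))\<^sup>2 * (- (\<xi> \<bullet> (u y - \<psi> y))))}"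

end

theory Submission
  imports Defs
begin

text \<open>
  Write \<open>w\<close> for the remainder of \<open>u\<close> after subtracting the quadratic polynomial given by
  \<open>(P, X)\<close>, and \<open>h = z - x\<close>. The largest eigenvalue of \<open>vee \<xi> w\<close> is \<open>(norm w + \<xi> \<bullet> w) / 2\<close>, so
  \<open>(P, X)\<close> is a contact jet iff \<open>X\<close> is symmetric and \<open>norm w + \<xi> \<bullet> w\<close> is at most \<open>o(norm h\<^sup>2)\<close>.
  Since \<open>norm (perp \<xi> w)\<^sup>2 = (norm w + \<xi> \<bullet> w) (norm w - \<xi> \<bullet> w)\<close>, the cone condition on \<open>u - \<psi>\<close>
  yields this bound by Taylor's formula for \<open>\<psi>\<close>. Conversely, one takes for \<open>\<psi>\<close> the quadratic
  polynomial plus \<open>\<rho>(h) \<xi>\<close>, where \<open>\<rho>\<close> is a C2 function whose 2-jet vanishes at 0 and that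
  dominates the given \<open>o(norm h\<^sup>2)\<close>. Such a \<open>\<rho>\<close> is a series
  \<open>\<Sum>k. 2^-k q\<^sup>2 / (q + d k)\<close> in \<open>q = norm h\<^sup>2\<close> with \<open>d k\<close> tending to 0 fast enough: the Hessians
  (in \<open>h\<close>) of \<open>q\<^sup>2 / (q + d)\<close> vanish at 0 and are bounded uniformly in \<open>d > 0\<close>, while
  \<open>q\<^sup>2 / (q + d) \<ge> q / 2\<close> for \<open>q \<ge> d\<close>.
\<close>

section \<open>Matrix-vector products and term-by-term differentiation\<close>

text \<open>The norm of a matrix is the Frobenius norm, so Cauchy-Schwarz in each row
  suffices.\<close>

lemma norm_matrix_vector_mult_le:
  fixes A :: "real^'n^'m"
  shows "norm (A *v v) \<le> norm A * norm v"
proof -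
  have "norm (A *v v) = L2_set (\<lambda>i. \<bar>A $ i \<bullet> v\<bar>) UNIV"
    by (simp add: norm_vec_def matrix_vector_mul_component)
  also have "\<dots> \<le> L2_set (\<lambda>i. norm (A $ i) * norm v) UNIV"
    by (intro L2_set_mono) (auto simp: Cauchy_Schwarz_ineq2)
  also have "\<dots> = norm A * norm v"
    by (simp add: L2_set_left_distrib norm_vec_def)
  finally show ?thesis .
qed

lemma bounded_bilinear_matrix_vector_mult:
  "bounded_bilinear ((*v) :: real^'n^'m \<Rightarrow> real^'n \<Rightarrow> real^'m)"
proof
  show "\<exists>K. \<forall>a b. norm ((a :: real^'n^'m) *v b) \<le> norm a * norm b * K"
    by (rule exI[of _ 1]) (simp add: norm_matrix_vector_mult_le)
qed (auto simp: matrix_vector_mult_add_rdistrib matrix_vector_right_distrib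
       scaleR_matrix_vector_assoc matrix_vector_mult_scaleR)

lemma jacobian_unique:
  fixes f :: "real^'n \<Rightarrow> real^'m"
  assumes "(f has_derivative (\<lambda>v. A *v v)) (at x)"
  shows "jacobian f (at x) = A"
  by (simp add: jacobian_def flip: frechet_derivative_at[OF assms])

text \<open>Derivatives are represented through \<open>B\<close> so that the same result serves
  gradients (inner product) and Hessians (matrix-vector product). The M-test is applied to the
  representatives \<open>f' n x\<close>; boundedness of \<open>B\<close> turns it into uniform
  convergence of the derivatives.\<close>

lemma has_derivative_suminf:
  fixes f :: "nat \<Rightarrow> 'a::real_normed_vector \<Rightarrow> 'b::banach"
    and f' :: "nat \<Rightarrow> 'a \<Rightarrow> 'c::banach"
  assumes B: "bounded_bilinear B" and S: "convex S" "open S"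
    and der: "\<And>n x. x \<in> S \<Longrightarrow> (f n has_derivative B (f' n x)) (at x)"
    and bound: "\<And>n x. x \<in> S \<Longrightarrow> norm (f' n x) \<le> M n" and M: "summable M"
    and a: "a \<in> S" "summable (\<lambda>n. f n a)" and x: "x \<in> S"
  shows "((\<lambda>y. \<Sum>n. f n y) has_derivative B (\<Sum>n. f' n x)) (at x)"
proof -
  interpret B: bounded_bilinear B by fact
  obtain K where K: "K > 0" "\<And>a b. norm (B a b) \<le> norm a * norm b * K"
    using B.pos_bounded by blast
  have ul: "uniform_limit S (\<lambda>n x. \<Sum>i<n. f' i x) (\<lambda>x. \<Sum>i. f' i x) sequentially"
    by (rule Weierstrass_m_test[OF bound M])
  have "\<forall>\<^sub>F n in sequentially. \<forall>x\<in>S. \<forall>h.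
      norm ((\<Sum>i<n. B (f' i x) h) - B (\<Sum>i. f' i x) h) \<le> e * norm h" if e: "e > 0" for e
  proof -
    have "\<forall>\<^sub>F n in sequentially. \<forall>x\<in>S. dist (\<Sum>i<n. f' i x) (\<Sum>i. f' i x) < e / K"
      using ul e K(1) by (auto simp: uniform_limit_iff)
    then show ?thesis
    proof eventually_elim
      case (elim n)
      show ?case
      proof (intro ballI allI)
        fix x h assume "x \<in> S"
        have "norm ((\<Sum>i<n. B (f' i x) h) - B (\<Sum>i. f' i x) h)
            = norm (B ((\<Sum>i<n. f' i x) - (\<Sum>i. f' i x)) h)"
          by (simp add: B.diff_left B.sum_left)
        also have "\<dots> \<le> norm ((\<Sum>i<n. f' i x) - (\<Sum>i. f' i x)) * norm h * K"
          by (rule K)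
        also have "\<dots> \<le> e / K * norm h * K"
          using elim \<open>x \<in> S\<close> K(1) by (intro mult_right_mono) (auto simp: dist_norm less_imp_le)
        finally show "norm ((\<Sum>i<n. B (f' i x) h) - B (\<Sum>i. f' i x) h) \<le> e * norm h"
          using K(1) by simp
      qed
    qed
  qed
  from has_derivative_series[where f' = "\<lambda>n x. B (f' n x)", OF S(1) has_derivative_at_withinI[OF der] this a(1)
      summable_sums[OF a(2)]]
  obtain g where g: "\<And>x. x \<in> S \<Longrightarrow> (\<lambda>n. f n x) sums g x"
      "\<And>x. x \<in> S \<Longrightarrow> (g has_derivative B (\<Sum>n. f' n x)) (at x within S)"
    by blast
  have "(g has_derivative B (\<Sum>n. f' n x)) (at x)"
    using g(2)[OF x] unfolding at_within_open[OF x S(2)] .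
  then show ?thesis
    by (rule has_derivative_transform_within_open[OF _ S(2) x]) (rule sums_unique[OF g(1)])
qed

section \<open>Symmetry of second derivatives and Taylor's formula\<close>

text \<open>The mean value theorem in direction \<open>v\<close>, applied to the increment of
  \<open>f\<close> by \<open>t *\<^sub>R w\<close>, leaves a difference of gradients at two points
  near \<open>x\<close>. Each is expanded around \<open>x\<close>; the two remainders account for
  the factor 2.\<close>

lemma second_difference_bound:
  fixes f :: "'a::real_inner \<Rightarrow> real" and g :: "'a \<Rightarrow> 'a"
  assumes f: "\<And>y. (f has_derivative (\<lambda>v. g y \<bullet> v)) (at y)" and A: "bounded_linear A"
    and t: "0 < t" "t * (norm v + norm w) < d" and e: "e \<ge> 0"
    and g: "\<And>y. norm (y - x) < d \<Longrightarrow> norm (g y - g x - A (y - x)) \<le> e * norm (y - x)"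
  shows "\<bar>(f (x + t *\<^sub>R v + t *\<^sub>R w) - f (x + t *\<^sub>R v) - f (x + t *\<^sub>R w) + f x) - t\<^sup>2 * (A w \<bullet> v)\<bar>
     \<le> t\<^sup>2 * (2 * e * (norm v + norm w)\<^sup>2)"
proof -
  interpret A: bounded_linear A by fact
  define \<phi> where "\<phi> s = f (x + s *\<^sub>R v + t *\<^sub>R w) - f (x + s *\<^sub>R v)" for s
  define R where "R y = g y - g x - A (y - x)" for y
  have D: "(\<phi> has_real_derivative (g (x + s *\<^sub>R v + t *\<^sub>R w) - g (x + s *\<^sub>R v)) \<bullet> v) (at s)" for s
    unfolding \<phi>_def has_field_derivative_def
    by (auto intro!: derivative_eq_intros has_derivative_compose[OF _ f] simp: inner_diff_left algebra_simps)
  obtain s where s: "0 < s" "s < t"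
    and eq: "\<phi> t - \<phi> 0 = (t - 0) * ((g (x + s *\<^sub>R v + t *\<^sub>R w) - g (x + s *\<^sub>R v)) \<bullet> v)"
    using MVT2[of 0 t \<phi>, OF t(1) D] by blast
  let ?y = "x + s *\<^sub>R v + t *\<^sub>R w" and ?z = "x + s *\<^sub>R v" and ?N = "norm v + norm w"
  have nz: "norm (?z - x) \<le> t * ?N"
  proof -
    have "norm (?z - x) = s * norm v" using s by simp
    also have "\<dots> \<le> t * ?N" using s by (intro mult_mono) auto
    finally show ?thesis .
  qed
  have ny: "norm (?y - x) \<le> t * ?N"
  proof -
    have "norm (?y - x) \<le> norm (s *\<^sub>R v) + norm (t *\<^sub>R w)"
      by (metis add.assoc add_diff_cancel_left' norm_triangle_ineq)
    also have "\<dots> = s * norm v + t * norm w" using s t by simp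
    also have "\<dots> \<le> t * ?N" using s by (simp add: distrib_left mult_right_mono)
    finally show ?thesis .
  qed
  have Ry: "norm (R ?y) \<le> e * (t * ?N)" and Rz: "norm (R ?z) \<le> e * (t * ?N)"
    using g[of ?y] g[of ?z] ny nz t(2) e mult_left_mono[OF ny e] mult_left_mono[OF nz e]
    unfolding R_def by (auto intro: order_trans)
  \<comment> \<open>The terms \<open>A (s *\<^sub>R v)\<close> of both expansions cancel, so the
    unknown intermediate \<open>s\<close> leaves the main term.\<close>
  have gyz: "g ?y - g ?z = t *\<^sub>R A w + (R ?y - R ?z)"
    by (simp add: R_def A.add A.scaleR algebra_simps)
  have "\<phi> t - \<phi> 0 - t\<^sup>2 * (A w \<bullet> v) = t * ((R ?y - R ?z) \<bullet> v)"
    using eq unfolding gyz by (simp add: inner_add_left distrib_left power2_eq_square)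
  moreover have "\<bar>t * ((R ?y - R ?z) \<bullet> v)\<bar> \<le> t\<^sup>2 * (2 * e * ?N\<^sup>2)"
  proof -
    have "\<bar>(R ?y - R ?z) \<bullet> v\<bar> \<le> norm (R ?y - R ?z) * norm v"
      by (rule Cauchy_Schwarz_ineq2)
    also have "\<dots> \<le> (2 * e * (t * ?N)) * ?N"
      using Ry Rz norm_triangle_ineq4[of "R ?y" "R ?z"] e t(1)
      by (intro mult_mono) (auto intro!: mult_nonneg_nonneg)
    finally have "t * \<bar>(R ?y - R ?z) \<bullet> v\<bar> \<le> t * ((2 * e * (t * ?N)) * ?N)"
      using t(1) by (intro mult_left_mono) auto
    then show ?thesis using t(1) by (simp add: abs_mult power2_eq_square mult_ac)
  qed
  ultimately show ?thesis by (simp add: \<phi>_def algebra_simps)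
qed

text \<open>The second difference of \<open>f\<close> is symmetric in its two increments.\<close>

lemma second_derivative_symmetric:
  fixes f :: "'a::real_inner \<Rightarrow> real" and g :: "'a \<Rightarrow> 'a"
  assumes f: "\<And>y. (f has_derivative (\<lambda>v. g y \<bullet> v)) (at y)" and g: "(g has_derivative A) (at x)"
  shows "A w \<bullet> v = A v \<bullet> w"
proof -
  have A: "bounded_linear A" using g by (rule has_derivative_bounded_linear)
  define N where "N = norm v + norm w"
  have N: "N \<ge> 0" by (simp add: N_def)
  have "\<bar>A w \<bullet> v - A v \<bullet> w\<bar> \<le> 0 + e" if "e > 0" for e
  proof -
    \<comment> \<open>Two errors \<open>2 * e' * N\<^sup>2\<close> have to add up to at most
      \<open>e\<close>; the added 1 keeps \<open>K\<close> positive when both increments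
      vanish.\<close>
    define K where "K = N\<^sup>2 + 1"
    have K: "K > 0" "N\<^sup>2 \<le> K" by (auto simp: K_def intro: add_nonneg_pos)
    define e' where "e' = e / K / 4"
    have e': "e' > 0" using that K by (simp add: e'_def)
    obtain d where d: "d > 0"
      "\<And>y. norm (y - x) < d \<Longrightarrow> norm (g y - g x - A (y - x)) \<le> e' * norm (y - x)"
      using g e' unfolding has_derivative_at_alt by blast
    define t where "t = d / (N + 1) / 2"
    have t: "t > 0" using d N by (simp add: t_def)
    have "t * (N + 1) = d / 2" using N by (simp add: t_def field_simps)
    then have tN: "t * N < d" using t d(1) by (simp add: distrib_left)
    let ?\<Delta> = "f (x + t *\<^sub>R v + t *\<^sub>R w) - f (x + t *\<^sub>R v) - f (x + t *\<^sub>R w) + f x"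
    have 1: "\<bar>?\<Delta> - t\<^sup>2 * (A w \<bullet> v)\<bar> \<le> t\<^sup>2 * (2 * e' * N\<^sup>2)"
      unfolding N_def by (rule second_difference_bound[OF f A t _ _ d(2)]) (use tN e' in \<open>auto simp: N_def\<close>)
    have "\<bar>(f (x + t *\<^sub>R w + t *\<^sub>R v) - f (x + t *\<^sub>R w) - f (x + t *\<^sub>R v) + f x) - t\<^sup>2 * (A v \<bullet> w)\<bar>
       \<le> t\<^sup>2 * (2 * e' * (norm w + norm v)\<^sup>2)"
      by (rule second_difference_bound[OF f A t _ _ d(2)]) (use tN e' in \<open>auto simp: N_def add.commute\<close>)
    then have 2: "\<bar>?\<Delta> - t\<^sup>2 * (A v \<bullet> w)\<bar> \<le> t\<^sup>2 * (2 * e' * N\<^sup>2)"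
      by (simp add: N_def algebra_simps)
    have "t\<^sup>2 * \<bar>A w \<bullet> v - A v \<bullet> w\<bar> = \<bar>t\<^sup>2 * (A w \<bullet> v) - t\<^sup>2 * (A v \<bullet> w)\<bar>"
      by (simp add: abs_mult flip: right_diff_distrib)
    also have "\<dots> \<le> t\<^sup>2 * (4 * e' * N\<^sup>2)" using 1 2 by linarith
    finally have "\<bar>A w \<bullet> v - A v \<bullet> w\<bar> \<le> 4 * e' * N\<^sup>2" using t by simp
    also have "\<dots> = e * (N\<^sup>2 / K)" by (simp add: e'_def)
    also have "\<dots> \<le> e * 1" using that K by (intro mult_left_mono) (auto simp: divide_le_eq_1)
    finally show ?thesis by simp
  qed
  then have "\<bar>A w \<bullet> v - A v \<bullet> w\<bar> \<le> 0" by (rule field_le_epsilon)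
  then show ?thesis by simp
qed

text \<open>Mean value theorem along the segment, after removing the first and second order terms:
  the derivative that remains is the first-order remainder of \<open>g\<close> at \<open>x\<close>,
  paired with the increment.\<close>

lemma taylor_second_order:
  fixes f :: "'a::real_inner \<Rightarrow> real" and g :: "'a \<Rightarrow> 'a"
  assumes f: "\<And>y. (f has_derivative (\<lambda>v. g y \<bullet> v)) (at y)" and g: "(g has_derivative A) (at x)"
    and e: "e > 0"
  shows "\<forall>\<^sub>F y in at x. \<bar>f y - f x - g x \<bullet> (y - x) - (1/2) * ((y - x) \<bullet> A (y - x))\<bar> \<le> e * (norm (y - x))\<^sup>2"
proof -
  interpret A: bounded_linear A using g by (rule has_derivative_bounded_linear)
  obtain d where d: "d > 0"
    "\<And>y. norm (y - x) < d \<Longrightarrow> norm (g y - g x - A (y - x)) \<le> e * norm (y - x)"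
    using g e unfolding has_derivative_at_alt by blast
  have "\<bar>f y - f x - g x \<bullet> (y - x) - (1/2) * ((y - x) \<bullet> A (y - x))\<bar> \<le> e * (norm (y - x))\<^sup>2"
    if "dist y x < d" for y
  proof -
    define h where "h = y - x"
    define \<phi> where "\<phi> s = f (x + s *\<^sub>R h) - s * (g x \<bullet> h) - (1/2) * s\<^sup>2 * (h \<bullet> A h)" for s
    have D: "(\<phi> has_real_derivative (g (x + s *\<^sub>R h) - g x - s *\<^sub>R A h) \<bullet> h) (at s)" for s
      unfolding \<phi>_def has_field_derivative_def
      by (auto intro!: derivative_eq_intros has_derivative_compose[OF _ f]
          simp: inner_diff_left algebra_simps inner_commute)
    obtain s where s: "0 < s" "s < 1"
      and eq: "\<phi> 1 - \<phi> 0 = (1 - 0) * ((g (x + s *\<^sub>R h) - g x - s *\<^sub>R A h) \<bullet> h)"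
      using MVT2[of 0 1 \<phi>, OF _ D] by auto
    have sh: "norm (s *\<^sub>R h) \<le> norm h" using s by (simp add: mult_left_le_one_le)
    have "norm (g (x + s *\<^sub>R h) - g x - s *\<^sub>R A h) \<le> e * norm (s *\<^sub>R h)"
      using d(2)[of "x + s *\<^sub>R h"] sh that by (simp add: A.scaleR h_def dist_norm)
    also have "\<dots> \<le> e * norm h" using sh e by (intro mult_left_mono) auto
    finally have "norm (g (x + s *\<^sub>R h) - g x - s *\<^sub>R A h) * norm h \<le> e * norm h * norm h"
      by (intro mult_right_mono) auto
    then have "\<bar>(g (x + s *\<^sub>R h) - g x - s *\<^sub>R A h) \<bullet> h\<bar> \<le> e * (norm h)\<^sup>2"
      using Cauchy_Schwarz_ineq2 order_trans by (fastforce simp: power2_eq_square mult.assoc)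
    then show ?thesis using eq by (simp add: \<phi>_def h_def algebra_simps)
  qed
  then show ?thesis
    using d(1) by (auto simp: eventually_at)
qed

section \<open>The quadratic form of \<open>vee \<xi> w\<close>\<close>

lemma inner_vee_mult: "v \<bullet> (vee \<xi> w *v v) = (\<xi> \<bullet> v) * (w \<bullet> v)"
proof -
  have "vee \<xi> w *v v = (1/2) *\<^sub>R ((w \<bullet> v) *\<^sub>R \<xi> + (\<xi> \<bullet> v) *\<^sub>R w)"
  proof (rule vec_eq_iff[THEN iffD2], rule allI)
    fix i
    have "(vee \<xi> w *v v) $ i = (\<Sum>j\<in>UNIV. (\<xi> $ i / 2) * (w $ j * v $ j) + (w $ i / 2) * (\<xi> $ j * v $ j))"
      unfolding matrix_vector_mult_def vee_def vec_lambda_beta by (intro sum.cong) (auto simp: field_simps)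
    also have "\<dots> = (\<xi> $ i / 2) * (w \<bullet> v) + (w $ i / 2) * (\<xi> \<bullet> v)"
      by (simp add: sum.distrib inner_vec_def sum_distrib_left)
    finally show "(vee \<xi> w *v v) $ i = ((1/2) *\<^sub>R ((w \<bullet> v) *\<^sub>R \<xi> + (\<xi> \<bullet> v) *\<^sub>R w)) $ i"
      by (simp add: field_simps)
  qed
  then show ?thesis
    by (simp add: inner_add_right inner_commute algebra_simps)
qed

text \<open>Polarization with the direction \<open>q\<close> of \<open>w\<close>: four times the
  product is the square of \<open>(\<xi> + q) \<bullet> v\<close> minus another square. The latter
  is dropped, and Cauchy-Schwarz bounds the former.\<close>

lemma inner_mult_inner_le:
  fixes \<xi> w v :: "'a::real_inner"
  assumes "norm \<xi> = 1"
  shows "(\<xi> \<bullet> v) * (w \<bullet> v) \<le> (norm w + \<xi> \<bullet> w) / 2 * (norm v)\<^sup>2"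
proof (cases "w = 0")
  case False
  define m where "m = norm w"
  define q where "q = w /\<^sub>R m"
  have m: "m > 0" and w: "w = m *\<^sub>R q" and q: "q \<bullet> q = 1" and \<xi>: "\<xi> \<bullet> \<xi> = 1"
    using False assms by (auto simp: m_def q_def power2_norm_eq_inner[symmetric] dot_square_norm)
  have "\<bar>(\<xi> + q) \<bullet> v\<bar>\<^sup>2 \<le> (norm (\<xi> + q) * norm v)\<^sup>2"
    by (intro power_mono Cauchy_Schwarz_ineq2) auto
  also have "\<dots> = (2 + 2 * (\<xi> \<bullet> q)) * (norm v)\<^sup>2"
    by (simp add: power_mult_distrib power2_norm_eq_inner inner_add_left inner_add_right q \<xi> inner_commute)
  finally have "((\<xi> + q) \<bullet> v)\<^sup>2 \<le> (2 + 2 * (\<xi> \<bullet> q)) * (norm v)\<^sup>2" by simp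
  moreover have "4 * ((\<xi> \<bullet> v) * (q \<bullet> v)) = ((\<xi> + q) \<bullet> v)\<^sup>2 - ((\<xi> - q) \<bullet> v)\<^sup>2"
    by (simp add: inner_add_left inner_diff_left power2_eq_square algebra_simps)
  ultimately have "4 * ((\<xi> \<bullet> v) * (q \<bullet> v)) \<le> (2 + 2 * (\<xi> \<bullet> q)) * (norm v)\<^sup>2"
    using zero_le_power2[of "(\<xi> - q) \<bullet> v"] by linarith
  then have "(\<xi> \<bullet> v) * (q \<bullet> v) \<le> (1 + \<xi> \<bullet> q) / 2 * (norm v)\<^sup>2"
    by (simp add: distrib_right)
  then have "m * ((\<xi> \<bullet> v) * (q \<bullet> v)) \<le> m * ((1 + \<xi> \<bullet> q) / 2 * (norm v)\<^sup>2)"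
    using m by (intro mult_left_mono) auto
  then show ?thesis unfolding m_def[symmetric] by (simp add: w algebra_simps)
qed auto

text \<open>The form is tested at \<open>\<xi> + q\<close>, where its value is
  \<open>m * c\<^sup>2\<close> while the squared norm is \<open>2 * c\<close>; one factor
  \<open>c > 0\<close> cancels. With the preceding bound,
  \<open>(norm w + \<xi> \<bullet> w) / 2\<close> is the positive part of the largest
  eigenvalue.\<close>

lemma norm_add_inner_le_of_mat_le_vee:
  fixes \<xi> w :: "real^'N"
  assumes \<xi>: "norm \<xi> = 1" and le: "mat_le (vee \<xi> w) A"
  shows "norm w + \<xi> \<bullet> w \<le> 2 * norm A"
proof (cases "norm w + \<xi> \<bullet> w \<le> 0")
  case True
  then show ?thesis by (meson norm_ge_zero order_trans mult_nonneg_nonneg zero_le_numeral)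
next
  case False
  then have w0: "w \<noteq> 0" by auto
  define m where "m = norm w"
  define q where "q = w /\<^sub>R m"
  have m: "m > 0" and w: "w = m *\<^sub>R q" and q: "q \<bullet> q = 1" and \<xi>1: "\<xi> \<bullet> \<xi> = 1"
    using w0 \<xi> by (auto simp: m_def q_def power2_norm_eq_inner[symmetric] dot_square_norm)
  define c where "c = 1 + \<xi> \<bullet> q"
  \<comment> \<open>the top eigenvector of \<open>vee \<xi> w\<close>\<close>
  define v where "v = \<xi> + q"
  have eq: "norm w + \<xi> \<bullet> w = m * c" unfolding m_def[symmetric] by (simp add: w c_def algebra_simps)
  then have "m * c > 0" using False by linarith
  then have c: "c > 0" using m by (simp add: zero_less_mult_iff)
  have nv: "norm v * norm v = 2 * c"
    by (simp add: v_def c_def power2_eq_square[symmetric] power2_norm_eq_inner inner_add_left inner_add_right q \<xi>1 inner_commute)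
  have "(\<xi> \<bullet> v) * (w \<bullet> v) \<le> v \<bullet> (A *v v)"
    using le unfolding mat_le_def inner_vee_mult by blast
  also have "\<dots> \<le> norm v * (norm A * norm v)"
    by (rule order_trans[OF norm_cauchy_schwarz]) (intro mult_left_mono norm_matrix_vector_mult_le norm_ge_zero)
  also have "\<dots> = c * (2 * norm A)" using nv by (simp add: algebra_simps)
  also have "(\<xi> \<bullet> v) * (w \<bullet> v) = c * (m * c)"
    by (simp add: w v_def c_def inner_add_right q \<xi>1 inner_commute algebra_simps)
  finally show ?thesis using c eq by simp
qed

section \<open>Regularized quadratics and the C2 majorant\<close>

text \<open>For \<open>d > 0\<close> this is of fourth order in \<open>h\<close> at 0, yet
  comparable to \<open>h \<bullet> h\<close> once \<open>h \<bullet> h \<ge> d\<close>.\<close>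

definition majorant :: "real \<Rightarrow> real^'n \<Rightarrow> real" where
  "majorant d h = (h \<bullet> h)\<^sup>2 / (h \<bullet> h + d)"

text \<open>Twice the derivative of \<open>q\<^sup>2 / (q + d)\<close> at
  \<open>q = h \<bullet> h\<close>; the gradient of \<open>majorant d\<close> at \<open>h\<close> is
  this multiple of \<open>h\<close>.\<close>

definition majorant_coeff :: "real \<Rightarrow> real^'n \<Rightarrow> real" where
  "majorant_coeff d h = 2 * (1 - d\<^sup>2 / (h \<bullet> h + d)\<^sup>2)"

definition majorant_hess :: "real \<Rightarrow> real^'n \<Rightarrow> real^'n^'n" where
  "majorant_hess d h = majorant_coeff d h *\<^sub>R mat 1 + (8 * d\<^sup>2 / (h \<bullet> h + d)^3) *\<^sub>R (\<chi> i. (h $ i) *\<^sub>R h)"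

lemma has_derivative_radial:
  fixes h :: "'a::real_inner"
  assumes "(\<phi> has_real_derivative D) (at (h \<bullet> h))"
  shows "((\<lambda>h. \<phi> (h \<bullet> h)) has_derivative (\<lambda>v. 2 * D * (h \<bullet> v))) (at h)"
proof -
  have "((\<lambda>h. h \<bullet> h) has_derivative (\<lambda>v. 2 * (h \<bullet> v))) (at h)"
    by (auto intro!: derivative_eq_intros simp: inner_commute)
  from has_derivative_compose[OF this assms[unfolded has_field_derivative_def]]
  show ?thesis by (simp add: mult_ac)
qed

lemma has_derivative_majorant:
  assumes d: "d > 0"
  shows "(majorant d has_derivative (\<lambda>v. (majorant_coeff d h *\<^sub>R h) \<bullet> v)) (at h)"
proof -
  have nz: "h \<bullet> h + d \<noteq> 0" using d inner_ge_zero[of h] by linarith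
  have "((\<lambda>q. q\<^sup>2 / (q + d)) has_real_derivative 1 - d\<^sup>2 / (h \<bullet> h + d)\<^sup>2) (at (h \<bullet> h))"
    using nz by (auto intro!: derivative_eq_intros simp: divide_simps) (simp add: power2_eq_square algebra_simps)
  from has_derivative_radial[OF this] show ?thesis
    unfolding majorant_def[abs_def] majorant_coeff_def by simp
qed

lemma outer_mult_vec:
  fixes h :: "real^'n"
  shows "(\<chi> i. (h $ i) *\<^sub>R h) *v v = (h \<bullet> v) *\<^sub>R h"
  by (simp add: vec_eq_iff matrix_vector_mul_component)

lemma norm_outer:
  fixes h :: "real^'n"
  shows "norm (\<chi> i. (h $ i) *\<^sub>R h) = h \<bullet> h"
proof -
  have "norm (\<chi> i. (h $ i) *\<^sub>R h) = L2_set (\<lambda>i. \<bar>h $ i\<bar> * norm h) UNIV"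
    by (simp add: norm_vec_def[of "\<chi> i. (h $ i) *\<^sub>R h"])
  also have "\<dots> = norm h * norm h"
    by (simp add: L2_set_left_distrib norm_vec_def)
  finally show ?thesis by (simp add: dot_square_norm power2_eq_square)
qed

lemma has_derivative_majorant_grad:
  fixes h :: "real^'n"
  assumes d: "d > 0"
  shows "((\<lambda>h. majorant_coeff d h *\<^sub>R h) has_derivative (\<lambda>v. majorant_hess d h *v v)) (at h)"
proof -
  have nz: "h \<bullet> h + d \<noteq> 0" using d inner_ge_zero[of h] by linarith
  have "(majorant_coeff d has_derivative (\<lambda>v. 8 * d\<^sup>2 / (h \<bullet> h + d)^3 * (h \<bullet> v))) (at h)"
  proof -
    have "((\<lambda>q. 2 * (1 - d\<^sup>2 / (q + d)\<^sup>2)) has_real_derivative 4 * d\<^sup>2 / (h \<bullet> h + d)^3) (at (h \<bullet> h))"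
      by (rule derivative_eq_intros refl power_not_zero nz)+
        (use nz in \<open>simp add: divide_simps\<close>, simp add: power2_eq_square power3_eq_cube power4_eq_xxxx algebra_simps)
    from has_derivative_radial[OF this] show ?thesis
      unfolding majorant_coeff_def[abs_def] by simp
  qed
  from has_derivative_scaleR[OF this has_derivative_ident]
  show ?thesis
    by (simp add: majorant_hess_def matrix_vector_mult_add_rdistrib outer_mult_vec
        scaleR_matrix_vector_assoc[symmetric] add.commute)
qed

text \<open>The bounds on coefficient and Hessian are free of \<open>d\<close>, so the series
  converges however fast the \<open>d k\<close> shrink. The outer product has norm
  \<open>q = h \<bullet> h\<close>, and \<open>d\<^sup>2 * q \<le> (q + d)^3\<close> bounds its
  contribution by 8.\<close>

lemma majorant_bounds:
  fixes h :: "real^'n"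
  assumes d: "d > 0"
  shows "0 \<le> majorant d h" "\<bar>majorant_coeff d h\<bar> \<le> 2"
    "norm (majorant_hess d h) \<le> 2 * norm (mat 1 :: real^'n^'n) + 8"
    "d \<le> h \<bullet> h \<Longrightarrow> (h \<bullet> h) / 2 \<le> majorant d h"
proof -
  let ?q = "h \<bullet> h"
  have q: "?q \<ge> 0" by simp
  then have p: "?q + d > 0" using d by linarith
  show "0 \<le> majorant d h" using p by (simp add: majorant_def)
  have "d\<^sup>2 \<le> (?q + d)\<^sup>2" using q d by (intro power_mono) auto
  then have "0 \<le> 1 - d\<^sup>2 / (?q + d)\<^sup>2" "d\<^sup>2 / (?q + d)\<^sup>2 \<ge> 0" using p by (auto simp: divide_le_eq_1)
  then show c: "\<bar>majorant_coeff d h\<bar> \<le> 2" by (simp add: majorant_coeff_def)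
  have "d\<^sup>2 * ?q \<le> (?q + d)\<^sup>2 * (?q + d)"
    using q d by (intro mult_mono power_mono) auto
  also have "\<dots> = (?q + d)^3" by (simp add: power2_eq_square power3_eq_cube)
  finally have "8 * d\<^sup>2 / (?q + d)^3 * ?q \<le> 8"
    using p by (simp add: divide_le_eq)
  moreover have "norm (majorant_hess d h) \<le> \<bar>majorant_coeff d h\<bar> * norm (mat 1 :: real^'n^'n) + 8 * d\<^sup>2 / (?q + d)^3 * ?q"
    unfolding majorant_hess_def
    by (rule order_trans[OF norm_triangle_ineq]) (use p in \<open>simp add: norm_outer\<close>)
  moreover have "\<bar>majorant_coeff d h\<bar> * norm (mat 1 :: real^'n^'n) \<le> 2 * norm (mat 1 :: real^'n^'n)"
    using c by (intro mult_right_mono) auto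
  ultimately show "norm (majorant_hess d h) \<le> 2 * norm (mat 1 :: real^'n^'n) + 8" by linarith
  show "?q / 2 \<le> majorant d h" if "d \<le> ?q"
  proof -
    have "?q * (?q + d) \<le> ?q * (2 * ?q)" using that q by (intro mult_left_mono) auto
    then show ?thesis using p by (simp add: majorant_def field_simps power2_eq_square)
  qed
qed

lemma continuous_majorant_hess:
  assumes d: "d > 0"
  shows "continuous_on UNIV (majorant_hess d :: real^'n \<Rightarrow> real^'n^'n)"
proof -
  have "h \<bullet> h + d \<noteq> 0" for h :: "real^'n" using d inner_ge_zero[of h] by linarith
  then show ?thesis
    unfolding majorant_hess_def[abs_def] majorant_coeff_def
    by (intro continuous_intros) auto
qed

text \<open>The thresholds \<open>d k\<close> can be chosen from the smallness of \<open>s\<close>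
  alone, because the weights \<open>(1/2)^k\<close> already make the gradients summable locally and
  the Hessians globally. Each term has zero value, gradient and Hessian at 0, hence so does the
  sum.\<close>

lemma exists_C2_majorant:
  fixes s :: "real^'n \<Rightarrow> real"
  assumes s: "\<And>e. e > 0 \<Longrightarrow> \<forall>\<^sub>F h in at 0. s h \<le> e * (norm h)\<^sup>2"
  obtains \<rho> :: "real^'n \<Rightarrow> real" and G :: "real^'n \<Rightarrow> real^'n" and H :: "real^'n \<Rightarrow> real^'n^'n"
  where "\<And>h. (\<rho> has_derivative (\<lambda>v. G h \<bullet> v)) (at h)"
    and "\<And>h. (G has_derivative (\<lambda>v. H h *v v)) (at h)"
    and "continuous_on UNIV H" and "\<rho> 0 = 0" "G 0 = 0" "H 0 = 0"
    and "\<forall>\<^sub>F h in at 0. s h \<le> \<rho> h"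
proof -
  \<comment> \<open>Of the factor 4, one 2 pays for \<open>majorant\<close> reaching only half of
    \<open>h \<bullet> h\<close>, the other for the shift between consecutive indices below. The
    bound \<open>(1/2)^k\<close> forces the thresholds to 0.\<close>
  have "\<exists>d>0. d \<le> (1/2)^k \<and> (\<forall>h. h \<noteq> 0 \<longrightarrow> h \<bullet> h < d \<longrightarrow> s h \<le> (1/2)^k / 4 * (h \<bullet> h))" for k
  proof -
    obtain r where r: "r > 0" "\<And>h. h \<noteq> 0 \<Longrightarrow> norm h < r \<Longrightarrow> s h \<le> (1/2)^k / 4 * (norm h)\<^sup>2"
      using s[of "(1/2)^k / 4"] by (auto simp: eventually_at)
    have "norm h < r" if "h \<bullet> h < r\<^sup>2" for h :: "real^'n"
      using that r(1) by (simp add: power2_norm_eq_inner[symmetric] power2_less_imp_less)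
    then show ?thesis
      using r by (intro exI[of _ "min (r\<^sup>2) ((1/2)^k)"]) (auto simp: power2_norm_eq_inner)
  qed
  then obtain d where d: "\<And>k. d k > 0" "\<And>k. d k \<le> (1/2)^k"
    "\<And>k h. h \<noteq> 0 \<Longrightarrow> h \<bullet> h < d k \<Longrightarrow> s h \<le> (1/2)^k / 4 * (h \<bullet> h)"
    by metis
  define f where "f k h = (1/2)^k * majorant (d k) h" for k and h :: "real^'n"
  define g where "g k h = ((1/2)^k * majorant_coeff (d k) h) *\<^sub>R h" for k and h :: "real^'n"
  define H where "H k h = (1/2)^k *\<^sub>R majorant_hess (d k) h" for k and h :: "real^'n"
  have geo: "summable (\<lambda>k. (1/2)^k * c)" for c :: real
    by (intro summable_mult2 summable_geometric) simp
  have df: "(f k has_derivative (\<lambda>v. g k h \<bullet> v)) (at h)" for k h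
    unfolding f_def[abs_def] g_def
    by (rule has_derivative_eq_rhs[OF has_derivative_mult_right[OF has_derivative_majorant[OF d(1)]]])
       (simp add: mult.assoc)
  have dg: "(g k has_derivative (\<lambda>v. H k h *v v)) (at h)" for k h
    using has_derivative_scaleR_right[OF has_derivative_majorant_grad[OF d(1)], of "(1/2)^k" k h]
    by (simp add: g_def[abs_def] H_def scaleR_matrix_vector_assoc)
  have ng: "norm (g k h) \<le> (1/2)^k * (2 * norm h)" for k h
    using majorant_bounds(2)[OF d(1), of k h] by (simp add: g_def abs_mult mult_right_mono)
  have nH: "norm (H k h) \<le> (1/2)^k * (2 * norm (mat 1 :: real^'n^'n) + 8)" for k h
    using majorant_bounds(3)[OF d(1), of k h] by (simp add: H_def)
  have at0: "f k 0 = 0" "g k 0 = 0" "H k 0 = 0" for k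
    using d(1)[of k] by (auto simp: f_def g_def H_def majorant_def majorant_coeff_def majorant_hess_def vec_eq_iff)
  show ?thesis
  proof (rule that)
    show "((\<lambda>h. \<Sum>k. f k h) has_derivative (\<lambda>v. (\<Sum>k. g k h) \<bullet> v)) (at h)" for h
    \<comment> \<open>The bound on the gradients grows with \<open>norm h\<close>, so the M-test
      runs on a ball, chosen to contain both \<open>h\<close> and the base point 0.\<close>
    proof (rule has_derivative_suminf[OF bounded_bilinear_inner _ _ df, where S = "ball 0 (norm h + 1)" and a = 0])
      show "norm (g k y) \<le> (1/2)^k * (2 * (norm h + 1))" if "y \<in> ball 0 (norm h + 1)" for k y
        by (rule order_trans[OF ng]) (use that in auto)
    qed (use geo at0 in \<open>auto intro: add_nonneg_pos\<close>)
    show "((\<lambda>h. \<Sum>k. g k h) has_derivative (\<lambda>v. (\<Sum>k. H k h) *v v)) (at h)" for h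
      by (rule has_derivative_suminf[OF bounded_bilinear_matrix_vector_mult _ _ dg nH geo, where S = UNIV and a = 0])
         (auto simp: at0)
    show "continuous_on UNIV (\<lambda>h. \<Sum>k. H k h)"
    proof (rule uniform_limit_theorem[OF _ Weierstrass_m_test[OF nH geo]])
      show "\<forall>\<^sub>F n in sequentially. continuous_on UNIV (\<lambda>h. \<Sum>k<n. H k h)"
        unfolding H_def by (intro always_eventually allI continuous_intros continuous_majorant_hess d)
    qed simp
    show "\<forall>\<^sub>F h in at 0. s h \<le> (\<Sum>k. f k h)"
    proof -
      have "s h \<le> (\<Sum>k. f k h)" if h: "h \<noteq> 0" "h \<bullet> h < d 0" for h
      proof -
        have hh: "h \<bullet> h > 0" using h by simp
        have "(\<lambda>k. (1/2)^k :: real) \<longlonglongrightarrow> 0" by (simp add: LIMSEQ_realpow_zero)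
        from order_tendstoD(2)[OF this hh] have "\<exists>k. (1/2)^k < h \<bullet> h"
          by (auto simp: eventually_sequentially)
        then have ex: "\<exists>k. d k \<le> h \<bullet> h" using d(2) by (meson less_imp_le order_trans)
        \<comment> \<open>For the first threshold not above \<open>h \<bullet> h\<close>, the
          preceding one still exceeds it: the estimate of \<open>s\<close> at index \<open>j\<close>
          meets the lower bound for the single term \<open>k\<close>. The assumption
          \<open>h \<bullet> h < d 0\<close> rules out \<open>k = 0\<close>.\<close>
        define k where "k = (LEAST k. d k \<le> h \<bullet> h)"
        have k: "d k \<le> h \<bullet> h" unfolding k_def using ex by (rule LeastI_ex)
        then obtain j where j: "k = Suc j" using h by (cases k) auto
        have "h \<bullet> h < d j"
          using not_less_Least[of j "\<lambda>k. d k \<le> h \<bullet> h"] j by (simp add: k_def)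
        then have "s h \<le> (1/2)^k * ((h \<bullet> h) / 2)" using d(3)[OF h(1), of j] by (simp add: j)
        also have "\<dots> \<le> f k h"
          unfolding f_def by (intro mult_left_mono majorant_bounds k d) auto
        also have "\<dots> \<le> (\<Sum>k. f k h)"
        proof -
          have "majorant (d k) h \<le> h \<bullet> h" for k
          proof -
            have "(h \<bullet> h)\<^sup>2 \<le> (h \<bullet> h) * (h \<bullet> h + d k)"
              using d(1)[of k] hh by (simp add: power2_eq_square)
            moreover have "h \<bullet> h + d k > 0" using d(1)[of k] hh by linarith
            ultimately show ?thesis by (simp add: majorant_def divide_le_eq)
          qed
          then have "norm (f k h) \<le> (1/2)^k * (h \<bullet> h)" for k
            using majorant_bounds(1)[OF d(1), of k h] by (simp add: f_def abs_mult)
          then have "summable (\<lambda>k. f k h)" by (rule summable_comparison_test'[OF geo])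
          moreover have "f i h \<ge> 0" for i
            using majorant_bounds(1)[OF d(1), of i h] by (simp add: f_def)
          ultimately show ?thesis
            using sum_le_suminf[of "\<lambda>k. f k h" "{k}"] by simp
        qed
        finally show ?thesis .
      qed
      moreover have "\<forall>\<^sub>F h in at (0 :: real^'n). h \<bullet> h < d 0"
      proof -
        have "((\<lambda>h :: real^'n. h \<bullet> h) \<longlongrightarrow> 0 \<bullet> (0 :: real^'n)) (at 0)"
          by (intro tendsto_intros)
        then show ?thesis using d(1)[of 0] by (simp add: order_tendstoD)
      qed
      moreover have "\<forall>\<^sub>F h in at (0 :: real^'n). h \<noteq> 0" by (simp add: eventually_at_filter)
      ultimately show ?thesis by (auto elim: eventually_elim2)
    qed
  qed (simp_all add: at0)
qed

section \<open>Contact jets as a scalar smallness condition\<close>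

lemma continuous_on_quadform [continuous_intros]:
  "continuous_on S f \<Longrightarrow> continuous_on S (\<lambda>y. quadform X (f y))"
  unfolding quadform_def
  by (intro continuous_intros bounded_linear.continuous_on[OF matrix_vector_mul_bounded_linear])

text \<open>By continuity of \<open>u\<close> the smallest admissible scalar \<open>T\<close> is continuous near \<open>0\<close>; it is
  extended by composing with the radial retraction onto a ball.\<close>

lemma J2xi_iff:
  fixes u :: "real^'n \<Rightarrow> real^'N"
  assumes \<Omega>: "open \<Omega>" "continuous_on \<Omega> u" "x \<in> \<Omega>" and \<xi>: "norm \<xi> = 1"
  defines "w \<equiv> \<lambda>P X z. u z - u x - P *v (z - x) - (1/2) *\<^sub>R quadform X (z - x)"
  shows "(P, X) \<in> J2xi u \<xi> x \<longleftrightarrow> (\<forall>\<alpha>. transpose (X $ \<alpha>) = X $ \<alpha>) \<and>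
    (\<forall>e>0. \<forall>\<^sub>F z in at x. norm (w P X z) + \<xi> \<bullet> w P X z \<le> e * (norm (z - x))\<^sup>2)"
    (is "_ \<longleftrightarrow> ?sym \<and> ?small")
proof
  assume "(P, X) \<in> J2xi u \<xi> x"
  then obtain T where sym: ?sym and T0: "(T \<longlongrightarrow> 0) (at 0)"
    and T: "\<forall>\<^sub>F z in at x. mat_le (vee \<xi> (w P X z)) ((norm (z - x))\<^sup>2 *\<^sub>R T (z - x))"
    unfolding J2xi_def w_def by auto
  have ?small
  proof (intro allI impI)
    fix e :: real assume e: "e > 0"
    have "\<forall>\<^sub>F h in at 0. norm (T h) < e / 2"
      using tendstoD[OF T0, of "e / 2"] e by simp
    then have "\<forall>\<^sub>F z in at x. norm (T (z - x)) < e / 2"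
      by (subst eventually_at_to_0) simp
    with T show "\<forall>\<^sub>F z in at x. norm (w P X z) + \<xi> \<bullet> w P X z \<le> e * (norm (z - x))\<^sup>2"
    proof eventually_elim
      case (elim z)
      have "norm (w P X z) + \<xi> \<bullet> w P X z \<le> (norm (z - x))\<^sup>2 * (2 * norm (T (z - x)))"
        using norm_add_inner_le_of_mat_le_vee[OF \<xi> elim(1)] by simp
      also have "\<dots> \<le> (norm (z - x))\<^sup>2 * e" using elim(2) by (intro mult_left_mono) auto
      finally show ?case by (simp add: mult.commute)
    qed
  qed
  with sym show "?sym \<and> ?small" by blast
next
  assume "?sym \<and> ?small"
  then have sym: ?sym and small: ?small by auto
  obtain r where r: "r > 0" "cball x r \<subseteq> \<Omega>"
    using \<Omega>(1,3) by (auto simp: open_contains_cball)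
  define W where "W h = w P X (x + h)" for h
  \<comment> \<open>By \<open>inner_mult_inner_le\<close>, the identity scaled by
    \<open>(norm h)\<^sup>2 * \<tau> h\<close> dominates \<open>vee \<xi> (W h)\<close>.\<close>
  define \<tau> where "\<tau> h = (norm (W h) + \<xi> \<bullet> W h) / (2 * (norm h)\<^sup>2)" for h
  \<comment> \<open>For \<open>h \<noteq> 0\<close> the point \<open>c h\<close> stays in the ball
    and never reaches 0, so \<open>\<tau>\<close> is evaluated only where it is continuous.\<close>
  define c where "c h = min 1 (r / norm h) *\<^sub>R h" for h :: "real^'n"
  have c_id: "c h = h" if "norm h \<le> r" "h \<noteq> 0" for h using that by (simp add: c_def min_def)
  have c_ran: "c h \<in> cball 0 r - {0}" if "h \<noteq> 0" for h
  proof -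
    have "norm (c h) = min 1 (r / norm h) * norm h" using r that by (simp add: c_def abs_of_pos)
    also have "\<dots> \<le> r / norm h * norm h" by (intro mult_right_mono) auto
    finally show ?thesis using that r by (auto simp: c_def min_def)
  qed
  have cont_W: "continuous_on (cball 0 r) W"
  proof -
    have "(+) x ` cball 0 r \<subseteq> \<Omega>" using r(2) by (auto simp: dist_norm)
    then have "continuous_on (cball 0 r) (\<lambda>h. u (x + h))"
      by (intro continuous_on_compose2[OF \<Omega>(2)] continuous_intros) auto
    then show ?thesis unfolding W_def w_def
      by (simp, intro continuous_intros bounded_linear.continuous_on[OF matrix_vector_mul_bounded_linear])
  qed
  have cont_\<tau>: "continuous_on (cball 0 r - {0}) \<tau>"
    unfolding \<tau>_def by (intro continuous_intros continuous_on_subset[OF cont_W]) auto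
  have cont_c: "continuous_on (-{0}) c"
    unfolding c_def by (intro continuous_intros) auto
  define T where "T h = \<tau> (c h) *\<^sub>R (mat 1 :: real^'N^'N)" for h
  have "continuous_on (-{0}) (\<lambda>h. \<tau> (c h))"
    by (rule continuous_on_compose2[OF cont_\<tau> cont_c]) (intro image_subsetI c_ran, simp)
  then have "continuous_on (-{0}) T"
    unfolding T_def by (intro continuous_on_scaleR continuous_on_const)
  moreover have "transpose (T y) = T y" for y
    by (simp add: T_def transpose_def mat_def vec_eq_iff)
  moreover have "(T \<longlongrightarrow> 0) (at 0)"
  proof -
    have "((\<lambda>h. \<tau> (c h)) \<longlongrightarrow> 0) (at 0)"
    proof (rule tendstoI)
      fix e :: real assume e: "e > 0"
      have "\<forall>\<^sub>F z in at x. norm (w P X z) + \<xi> \<bullet> w P X z \<le> e * (norm (z - x))\<^sup>2"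
        using small e by blast
      then have "\<forall>\<^sub>F h in at 0. norm (W h) + \<xi> \<bullet> W h \<le> e * (norm h)\<^sup>2"
        by (subst (asm) eventually_at_to_0) (simp add: W_def add.commute)
      moreover have "\<forall>\<^sub>F h in at 0. h \<noteq> (0 :: real^'n) \<and> norm h \<le> r"
        using r(1) by (auto simp: eventually_at intro!: exI[of _ r])
      ultimately show "\<forall>\<^sub>F h in at 0. dist (\<tau> (c h)) 0 < e"
      proof eventually_elim
        case (elim h)
        have "norm (W h) + \<xi> \<bullet> W h \<ge> 0"
          using Cauchy_Schwarz_ineq2[of \<xi> "W h"] \<xi> by simp
        then have "\<bar>\<tau> h\<bar> = \<tau> h" by (simp add: \<tau>_def)
        also have "\<dots> \<le> e / 2"
          using elim by (simp add: \<tau>_def divide_simps)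
        finally show ?case using elim e by (simp add: c_id)
      qed
    qed
    from tendsto_scaleR[OF this tendsto_const] show ?thesis unfolding T_def by simp
  qed
  moreover have "\<forall>\<^sub>F z in at x. mat_le (vee \<xi> (w P X z)) ((norm (z - x))\<^sup>2 *\<^sub>R T (z - x))"
  proof -
    have "mat_le (vee \<xi> (w P X z)) ((norm (z - x))\<^sup>2 *\<^sub>R T (z - x))" if "z \<noteq> x" "dist z x < r" for z
    proof -
      have "c (z - x) = z - x" using that by (intro c_id) (auto simp: dist_norm)
      then have "(norm (z - x))\<^sup>2 *\<^sub>R T (z - x) = ((norm (w P X z) + \<xi> \<bullet> w P X z) / 2) *\<^sub>R mat 1"
        using that by (simp add: T_def \<tau>_def W_def)
      then show ?thesis
        using inner_mult_inner_le[OF \<xi>, of _ "w P X z"]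
        by (auto simp: mat_le_def inner_vee_mult scaleR_matrix_vector_assoc[symmetric] power2_norm_eq_inner)
    qed
    then show ?thesis using r(1) by (auto simp: eventually_at)
  qed
  ultimately show "(P, X) \<in> J2xi u \<xi> x"
    using sym unfolding J2xi_def w_def by blast
qed

section \<open>Second order calculus of C2 maps\<close>

lemma C2_component_derivatives:
  fixes f :: "real^'n \<Rightarrow> real^'N"
  assumes "C2 f"
  shows "((\<lambda>z. f z $ \<alpha>) has_derivative (\<lambda>v. Dmat f y $ \<alpha> \<bullet> v)) (at y)"
    and "((\<lambda>z. Dmat f z $ \<alpha>) has_derivative (\<lambda>v. D2arr f y $ \<alpha> *v v)) (at y)"
proof -
  have "(f has_derivative (\<lambda>h. Dmat f y *v h)) (at y)"
    using assms by (simp add: C2_def Dmat_def flip: jacobian_works)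
  from bounded_linear.has_derivative[OF bounded_linear_vec_nth this, of \<alpha>]
  show "((\<lambda>z. f z $ \<alpha>) has_derivative (\<lambda>v. Dmat f y $ \<alpha> \<bullet> v)) (at y)"
    by (simp add: matrix_vector_mul_component)
  show "((\<lambda>z. Dmat f z $ \<alpha>) has_derivative (\<lambda>v. D2arr f y $ \<alpha> *v v)) (at y)"
    using assms by (simp add: C2_def D2arr_def flip: jacobian_works)
qed

text \<open>Contact jets demand symmetric arrays, and \<open>C2\<close> does not state this
  symmetry.\<close>

lemma transpose_D2arr:
  fixes f :: "real^'n \<Rightarrow> real^'N"
  assumes "C2 f"
  shows "transpose (D2arr f x $ \<alpha>) = D2arr f x $ \<alpha>"
proof -
  let ?A = "D2arr f x $ \<alpha>"
  have sym: "(?A *v v) \<bullet> w = (?A *v w) \<bullet> v" for v w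
    by (rule second_derivative_symmetric[OF C2_component_derivatives[OF assms]])
  have "(transpose ?A *v v) \<bullet> w = (?A *v v) \<bullet> w" for v w
    unfolding transpose_matrix_vector dot_lmul_matrix using sym[of v w] by (simp add: inner_commute)
  then have "transpose ?A *v v = ?A *v v" for v
    by (metis vector_eq_ldot inner_commute)
  then show ?thesis by (simp add: matrix_eq)
qed

lemma C2_taylor:
  fixes f :: "real^'n \<Rightarrow> real^'N"
  assumes "C2 f" and e: "e > 0"
  shows "\<forall>\<^sub>F y in at x. norm (f y - f x - Dmat f x *v (y - x) - (1/2) *\<^sub>R quadform (D2arr f x) (y - x))
           \<le> e * (norm (y - x))\<^sup>2"
proof -
  \<comment> \<open>The norm is bounded by the sum of the component errors, one for each of the
    \<open>CARD('N)\<close> components.\<close>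
  define e' where "e' = e / CARD('N)"
  have e': "e' > 0" using e by (simp add: e'_def)
  let ?r = "\<lambda>y. f y - f x - Dmat f x *v (y - x) - (1/2) *\<^sub>R quadform (D2arr f x) (y - x)"
  have "\<forall>\<^sub>F y in at x. \<forall>\<alpha>\<in>UNIV. \<bar>?r y $ \<alpha>\<bar> \<le> e' * (norm (y - x))\<^sup>2"
  proof (rule eventually_ball_finite)
    show "\<forall>\<alpha>\<in>UNIV. \<forall>\<^sub>F y in at x. \<bar>?r y $ \<alpha>\<bar> \<le> e' * (norm (y - x))\<^sup>2"
      using taylor_second_order[OF C2_component_derivatives[OF assms(1)] e', where x = x]
      by (simp add: matrix_vector_mul_component quadform_def)
  qed simp
  then show ?thesis
  proof eventually_elim
    case (elim y)
    have "norm (?r y) \<le> (\<Sum>\<alpha>\<in>UNIV. \<bar>?r y $ \<alpha>\<bar>)" by (rule norm_le_l1_cart)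
    also have "\<dots> \<le> (\<Sum>\<alpha>\<in>(UNIV :: 'N set). e' * (norm (y - x))\<^sup>2)" using elim by (intro sum_mono) blast
    also have "\<dots> = e * (norm (y - x))\<^sup>2" by (simp add: e'_def)
    finally show ?case .
  qed
qed

section \<open>The two inclusions\<close>

lemma norm_perp_squared:
  assumes "norm \<xi> = 1"
  shows "(norm (perp \<xi> v))\<^sup>2 = (norm v)\<^sup>2 - (\<xi> \<bullet> v)\<^sup>2"
proof -
  have "\<xi> \<bullet> \<xi> = 1" using assms by (simp add: dot_square_norm)
  then show ?thesis
    unfolding perp_def power2_norm_eq_inner
    by (simp add: inner_diff_left inner_diff_right inner_commute power2_eq_square)
qed

text \<open>The hypothesis forces \<open>a = \<xi> \<bullet> v\<close> to be nonpositive and gives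
  \<open>(norm v)\<^sup>2 \<le> a\<^sup>2 - m * a\<close>, which is at most
  \<open>(m - a)\<^sup>2\<close>.\<close>

lemma norm_add_inner_le_of_perp:
  assumes \<xi>: "norm \<xi> = 1" and m: "m > 0"
    and le: "(norm (perp \<xi> v))\<^sup>2 \<le> m * (- (\<xi> \<bullet> v))"
  shows "norm v + \<xi> \<bullet> v \<le> m"
proof -
  let ?a = "\<xi> \<bullet> v"
  have ma: "m * (- ?a) \<ge> 0" using le zero_le_power2 order_trans by blast
  then have a: "?a \<le> 0" using m by (simp add: mult_le_0_iff)
  have "(norm v)\<^sup>2 \<le> ?a\<^sup>2 + m * (- ?a)" using le norm_perp_squared[OF \<xi>, of v] by simp
  also have "\<dots> \<le> ?a\<^sup>2 + 2 * (m * (- ?a)) + m\<^sup>2"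
    using ma zero_le_power2[of m] by linarith
  also have "\<dots> = (m - ?a)\<^sup>2" by (simp add: power2_eq_square algebra_simps)
  finally have "norm v \<le> m - ?a" by (rule power2_le_imp_le) (use a m in simp)
  then show ?thesis by simp
qed

text \<open>The remainder of \<open>u\<close> is \<open>u - \<psi>\<close> plus the Taylor remainder
  \<open>R\<close> of \<open>\<psi>\<close>; adding \<open>R\<close> raises
  \<open>norm v + \<xi> \<bullet> v\<close> by at most \<open>2 * norm R\<close>.\<close>

lemma D2xi_subset_J2xi:
  fixes u :: "real^'n \<Rightarrow> real^'N"
  assumes \<Omega>: "open \<Omega>" "continuous_on \<Omega> u" "x \<in> \<Omega>" and \<xi>: "norm \<xi> = 1"
  shows "D2xi u \<xi> x \<subseteq> J2xi u \<xi> x"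
proof
  fix PX assume "PX \<in> D2xi u \<xi> x"
  then obtain \<psi> where PX: "PX = (Dmat \<psi> x, D2arr \<psi> x)" and C2: "C2 \<psi>" and \<psi>x: "\<psi> x = u x"
    and \<psi>: "\<And>L. L > 0 \<Longrightarrow> \<forall>\<^sub>F y in nhds x.
        (norm (perp \<xi> (u y - \<psi> y)))\<^sup>2 \<le> L\<^sup>2 * (norm (y - x))\<^sup>2 * (- (\<xi> \<bullet> (u y - \<psi> y)))"
    unfolding D2xi_def by auto
  let ?w = "\<lambda>z. u z - u x - Dmat \<psi> x *v (z - x) - (1/2) *\<^sub>R quadform (D2arr \<psi> x) (z - x)"
  let ?r = "\<lambda>z. \<psi> z - \<psi> x - Dmat \<psi> x *v (z - x) - (1/2) *\<^sub>R quadform (D2arr \<psi> x) (z - x)"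
  have "\<forall>\<^sub>F z in at x. norm (?w z) + \<xi> \<bullet> ?w z \<le> e * (norm (z - x))\<^sup>2" if e: "e > 0" for e
  proof -
    \<comment> \<open>The error \<open>e\<close> is split into twice \<open>e / 4\<close> from
      Taylor's formula and \<open>e / 2\<close> from the cone condition with
      \<open>L = sqrt (e / 2)\<close>. Below, \<open>y \<noteq> x\<close> is recorded to make the
      constant \<open>m\<close> of \<open>norm_add_inner_le_of_perp\<close> positive.\<close>
    have "\<forall>\<^sub>F y in at x. norm (?r y) \<le> e / 4 * (norm (y - x))\<^sup>2"
      using e by (intro C2_taylor[OF C2]) simp
    moreover have "\<forall>\<^sub>F y in at x. y \<noteq> x \<and>
        (norm (perp \<xi> (u y - \<psi> y)))\<^sup>2 \<le> (sqrt (e / 2))\<^sup>2 * (norm (y - x))\<^sup>2 * (- (\<xi> \<bullet> (u y - \<psi> y)))"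
      using \<psi>[of "sqrt (e / 2)"] e by (auto simp: eventually_at_filter elim: eventually_mono)
    ultimately show ?thesis
    proof eventually_elim
      case (elim z)
      define v where "v = u z - \<psi> z"
      have "norm v + \<xi> \<bullet> v \<le> e / 2 * (norm (z - x))\<^sup>2"
        using elim e by (intro norm_add_inner_le_of_perp[OF \<xi>]) (auto simp: v_def)
      moreover define R where "R = ?r z"
      moreover have "norm (v + R) \<le> norm v + norm R" by (rule norm_triangle_ineq)
      moreover have "\<xi> \<bullet> R \<le> norm R" using norm_cauchy_schwarz[of \<xi> R] \<xi> by simp
      ultimately have "norm (v + R) + \<xi> \<bullet> (v + R) \<le> e * (norm (z - x))\<^sup>2"
        using elim by (simp add: inner_add_right)
      moreover have "?w z = v + R" by (simp add: v_def R_def \<psi>x)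
      ultimately show ?case by simp
    qed
  qed
  then show "PX \<in> J2xi u \<xi> x"
    unfolding PX J2xi_iff[OF \<Omega> \<xi>] using transpose_D2arr[OF C2] by blast
qed

text \<open>Adding \<open>\<rho>\<close> times \<xi> to the quadratic polynomial leaves the normal
  projection of \<open>u - \<psi>\<close> unchanged and raises
  \<open>- (\<xi> \<bullet> (u - \<psi>))\<close> by \<open>\<rho>\<close>. One factor of the
  squared projection is then controlled by this raised quantity, the other by the smallness of the
  jet remainder.\<close>

lemma J2xi_subset_D2xi:
  fixes u :: "real^'n \<Rightarrow> real^'N"
  assumes \<Omega>: "open \<Omega>" "continuous_on \<Omega> u" "x \<in> \<Omega>" and \<xi>: "norm \<xi> = 1"
  shows "J2xi u \<xi> x \<subseteq> D2xi u \<xi> x"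
proof (rule subrelI)
  fix P X assume "(P, X) \<in> J2xi u \<xi> x"
  define w where "w z = u z - u x - P *v (z - x) - (1/2) *\<^sub>R quadform X (z - x)" for z
  from \<open>(P, X) \<in> J2xi u \<xi> x\<close> have sym: "\<And>\<alpha>. transpose (X $ \<alpha>) = X $ \<alpha>"
    and small: "\<And>e. e > 0 \<Longrightarrow> \<forall>\<^sub>F z in at x. norm (w z) + \<xi> \<bullet> w z \<le> e * (norm (z - x))\<^sup>2"
    unfolding J2xi_iff[OF \<Omega> \<xi>] w_def by blast+
  define s where "s h = norm (w (h + x)) + \<xi> \<bullet> w (h + x)" for h
  have s_small: "\<forall>\<^sub>F h in at 0. s h \<le> e * (norm h)\<^sup>2" if "e > 0" for e
    using small[OF that] by (subst (asm) eventually_at_to_0) (simp add: s_def)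
  obtain \<rho> :: "real^'n \<Rightarrow> real" and G :: "real^'n \<Rightarrow> real^'n" and H :: "real^'n \<Rightarrow> real^'n^'n"
  where d\<rho>: "\<And>h. (\<rho> has_derivative (\<lambda>v. G h \<bullet> v)) (at h)"
    and dG: "\<And>h. (G has_derivative (\<lambda>v. H h *v v)) (at h)"
    and H: "continuous_on UNIV H" and at0: "\<rho> 0 = 0" "G 0 = 0" "H 0 = 0"
    and maj: "\<forall>\<^sub>F h in at 0. s h \<le> \<rho> h"
    by (rule exists_C2_majorant, erule s_small, rule that; assumption)
  have maj': "\<forall>\<^sub>F z in at x. norm (w z) + \<xi> \<bullet> w z \<le> \<rho> (z - x)"
    using maj by (subst eventually_at_to_0) (simp add: s_def)
  define \<psi> where "\<psi> y = u x + P *v (y - x) + (1/2) *\<^sub>R quadform X (y - x) + \<rho> (y - x) *\<^sub>R \<xi>" for y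
  define D where "D y = (\<chi> \<alpha>. P $ \<alpha> + X $ \<alpha> *v (y - x) + (\<xi> $ \<alpha>) *\<^sub>R G (y - x))" for y
  define E where "E y = (\<chi> \<alpha>. X $ \<alpha> + (\<xi> $ \<alpha>) *\<^sub>R H (y - x))" for y
  have dX: "((\<lambda>y. X $ \<alpha> *v (y - x)) has_derivative (\<lambda>v. X $ \<alpha> *v v)) (at y)" for \<alpha> y
    by (rule has_derivative_eq_rhs[OF bounded_linear.has_derivative[OF matrix_vector_mul_bounded_linear]])
       (auto intro!: derivative_eq_intros)
  \<comment> \<open>Symmetry makes the two product-rule terms of the quadratic form agree, which
    cancels the factor 1/2.\<close>
  have symX: "h \<bullet> (X $ \<alpha> *v v) = (X $ \<alpha> *v h) \<bullet> v" for \<alpha> h v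
    using sym[of \<alpha>] by (metis dot_lmul_matrix vector_transpose_matrix)
  have d\<psi>: "(\<psi> has_derivative (\<lambda>v. D y *v v)) (at y)" for y
  proof -
    have id: "((\<lambda>y. y - x) has_derivative (\<lambda>v. v)) (at y)"
      by (auto intro!: derivative_eq_intros)
    have \<psi>_nth: "\<psi> y $ \<alpha> = u x $ \<alpha> + P $ \<alpha> \<bullet> (y - x) + (1/2) * ((y - x) \<bullet> (X $ \<alpha> *v (y - x)))
        + \<xi> $ \<alpha> * \<rho> (y - x)" for y \<alpha>
      by (simp add: \<psi>_def quadform_def matrix_vector_mul_component)
    have "((\<lambda>y. P $ \<alpha> \<bullet> (y - x)) has_derivative (\<lambda>v. P $ \<alpha> \<bullet> v)) (at y)" for \<alpha>
      by (rule has_derivative_inner_right[OF id])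
    moreover have "((\<lambda>y. (1/2) * ((y - x) \<bullet> (X $ \<alpha> *v (y - x)))) has_derivative
        (\<lambda>v. (1/2) * ((y - x) \<bullet> (X $ \<alpha> *v v) + v \<bullet> (X $ \<alpha> *v (y - x))))) (at y)" for \<alpha>
      by (rule has_derivative_mult_right[OF has_derivative_inner[OF id dX]])
    moreover have "((\<lambda>y. \<xi> $ \<alpha> * \<rho> (y - x)) has_derivative (\<lambda>v. \<xi> $ \<alpha> * (G (y - x) \<bullet> v))) (at y)" for \<alpha>
      by (rule has_derivative_mult_right[OF has_derivative_compose[OF id d\<rho>]])
    ultimately have "((\<lambda>y. \<psi> y $ \<alpha>) has_derivative (\<lambda>v. 0 + P $ \<alpha> \<bullet> v
        + (1/2) * ((y - x) \<bullet> (X $ \<alpha> *v v) + v \<bullet> (X $ \<alpha> *v (y - x)))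
        + \<xi> $ \<alpha> * (G (y - x) \<bullet> v))) (at y)" for \<alpha>
      unfolding \<psi>_nth by (intro has_derivative_add has_derivative_const)
    then have "((\<lambda>y. \<psi> y $ \<alpha>) has_derivative (\<lambda>v. D y $ \<alpha> \<bullet> v)) (at y)" for \<alpha>
      by (rule has_derivative_eq_rhs)
        (simp add: fun_eq_iff D_def symX[of "y - x"] inner_add_left inner_commute[of _ "X $ \<alpha> *v (y - x)"])
    then show ?thesis
      unfolding has_derivative_componentwise_within[of \<psi>]
      by (auto simp: Basis_vec_def inner_axis matrix_vector_mul_component)
  qed
  have Dmat: "Dmat \<psi> = D"
    using jacobian_unique[OF d\<psi>] by (auto simp: Dmat_def fun_eq_iff)
  have dD: "((\<lambda>y. D y $ \<alpha>) has_derivative (\<lambda>v. E y $ \<alpha> *v v)) (at y)" for y \<alpha>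
  proof -
    have "((\<lambda>y. G (y - x)) has_derivative (\<lambda>v. H (y - x) *v v)) (at y)" for y
      by (rule has_derivative_compose[OF _ dG, THEN has_derivative_eq_rhs]) (auto intro!: derivative_eq_intros)
    then show ?thesis unfolding D_def E_def
      by (auto intro!: derivative_eq_intros dX
          simp: matrix_vector_mult_add_rdistrib scaleR_matrix_vector_assoc)
  qed
  have D2arr: "D2arr \<psi> = E"
    using jacobian_unique[OF dD] by (auto simp: D2arr_def Dmat fun_eq_iff vec_eq_iff)
  have "C2 \<psi>"
    unfolding C2_def D2arr Dmat
  proof (intro conjI allI)
    show "continuous_on UNIV E"
      unfolding E_def by (intro continuous_intros continuous_on_compose2[OF H]) auto
  qed (use d\<psi> dD in \<open>auto simp: differentiable_def\<close>)
  moreover have "\<psi> x = u x" by (simp add: \<psi>_def at0 quadform_def vec_eq_iff)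
  moreover have "\<forall>\<^sub>F y in nhds x.
      (norm (perp \<xi> (u y - \<psi> y)))\<^sup>2 \<le> L\<^sup>2 * (norm (y - x))\<^sup>2 * (- (\<xi> \<bullet> (u y - \<psi> y)))" if L: "L > 0" for L
  proof -
    have "\<forall>\<^sub>F y in at x. norm (w y) + \<xi> \<bullet> w y \<le> L\<^sup>2 / 2 * (norm (y - x))\<^sup>2"
      using L by (intro small) simp
    with maj' have "\<forall>\<^sub>F y in at x.
      (norm (perp \<xi> (u y - \<psi> y)))\<^sup>2 \<le> L\<^sup>2 * (norm (y - x))\<^sup>2 * (- (\<xi> \<bullet> (u y - \<psi> y)))"
    proof eventually_elim
      case (elim y)
      let ?a = "\<xi> \<bullet> w y" and ?n = "norm (w y)" and ?\<rho> = "\<rho> (y - x)"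
      have \<xi>1: "\<xi> \<bullet> \<xi> = 1" using \<xi> by (simp add: dot_square_norm)
      have v: "u y - \<psi> y = w y - ?\<rho> *\<^sub>R \<xi>" by (simp add: \<psi>_def w_def)
      have perp: "perp \<xi> (u y - \<psi> y) = perp \<xi> (w y)"
        unfolding v perp_def by (simp add: inner_diff_right \<xi>1 scaleR_diff_left)
      have inner: "- (\<xi> \<bullet> (u y - \<psi> y)) = ?\<rho> - ?a" unfolding v by (simp add: inner_diff_right \<xi>1)
      have s0: "?n + ?a \<ge> 0" using Cauchy_Schwarz_ineq2[of \<xi> "w y"] \<xi> by simp
      have a: "?a \<le> ?n" using norm_cauchy_schwarz[of \<xi> "w y"] \<xi> by simp
      have "(norm (perp \<xi> (w y)))\<^sup>2 = (?n + ?a) * (?n - ?a)"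
        unfolding norm_perp_squared[OF \<xi>] by (simp add: power2_eq_square algebra_simps)
      \<comment> \<open>From \<open>0 \<le> ?n + ?a \<le> ?\<rho>\<close> one gets
        \<open>?n - ?a \<le> ?\<rho> - 2 * ?a \<le> 2 * (?\<rho> - ?a)\<close>. This 2 is why the
        smallness was invoked with \<open>L\<^sup>2 / 2\<close>.\<close>
      also have "\<dots> \<le> (L\<^sup>2 / 2 * (norm (y - x))\<^sup>2) * (2 * (?\<rho> - ?a))"
        using elim s0 a by (intro mult_mono) auto
      finally show ?case unfolding perp inner by (simp add: algebra_simps)
    qed
    \<comment> \<open>At \<open>y = x\<close> itself both sides vanish, so the punctured
      neighbourhood can be filled in.\<close>
    then show ?thesis
      using \<open>\<psi> x = u x\<close> by (simp add: eventually_nhds_conv_at perp_def)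
  qed
  moreover have "P = Dmat \<psi> x" "X = D2arr \<psi> x"
    unfolding Dmat D2arr by (simp_all add: D_def E_def at0 vec_eq_iff)
  ultimately show "(P, X) \<in> D2xi u \<xi> x"
    unfolding D2xi_def by blast
qed

theorem theorem35:
  fixes \<Omega> :: "(real^'n) set" and u :: "real^'n \<Rightarrow> real^'N"
    and x :: "real^'n" and \<xi> :: "real^'N"
  assumes "open \<Omega>" and "continuous_on \<Omega> u" and "x \<in> \<Omega>" and "norm \<xi> = 1"
  shows "D2xi u \<xi> x = J2xi u \<xi> x"
  using D2xi_subset_J2xi[OF assms] J2xi_subset_D2xi[OF assms] by blast

end
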